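(* Let $R$ be an NJ-reflexive ring. Then each of the following conditions implies that $R$ is reduced: (1) $R$ is semiprimitive. (2) $R$ is a left MC2 ring, and every simple singular left $R$-module is Wnil-injective.
   Context: All rings are associative with unity and all modules are unital. $N(R)$ denotes the set of nilpotent elements of $R$, $E(R)$ the set of idempotents of $R$, and $J(R)$ the Jacobson radical of $R$. A ring $R$ is NJ-reflexive if for all $x,y\in R$, $xRy\subseteq N(R)$ implies $yRx\subseteq J(R)$. A ring is reduced if $0$ is its only nilpotent element, and semiprimitive if $J(R)=0$. Let $ME_l(R)=\{e\in E(R): Re \text{ is a minimal left ideal of } R\}$. A ring $R$ is left MC2 if for all $a\in R$ and $e\in ME_l(R)$, $aRe=0$ implies $eRa=0$. A left $R$-module $M$ is Wnil-injective if for each nonzero $a\in N(R)$ there is a positive integer $k$ such that $a^k\neq 0$ and every left $R$-homomorphism from $Ra^k$ to $M$ extends to a left $R$-homomorphism from $R$ to $M$. *)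

theory Defs
  imports "HOL-Algebra.Module" "HOL-Algebra.Ideal"
begin

section \<open>Elements, ideals and the Jacobson radical of a noncommutative ring\<close>

definition nilpotents :: "('a, 'm) ring_scheme \<Rightarrow> 'a set" where
  "nilpotents R = {a \<in> carrier R. \<exists>n::nat. 0 < n \<and> a [^]\<^bsub>R\<^esub> n = \<zero>\<^bsub>R\<^esub>}"

definition idempotents :: "('a, 'm) ring_scheme \<Rightarrow> 'a set" where
  "idempotents R = {e \<in> carrier R. e \<otimes>\<^bsub>R\<^esub> e = e}"

definition reduced_ring :: "('a, 'm) ring_scheme \<Rightarrow> bool" where
  "reduced_ring R \<longleftrightarrow> nilpotents R = {\<zero>\<^bsub>R\<^esub>}"

locale left_ideal = additive_subgroup I R + ring R for I and R (structure) +
  assumes l_closed: "\<lbrakk>a \<in> I; r \<in> carrier R\<rbrakk> \<Longrightarrow> r \<otimes> a \<in> I"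

definition maximal_left_ideal :: "'a set \<Rightarrow> ('a, 'm) ring_scheme \<Rightarrow> bool" where
  "maximal_left_ideal I R \<longleftrightarrow> left_ideal I R \<and> I \<noteq> carrier R \<and>
     (\<forall>J. left_ideal J R \<and> I \<subseteq> J \<longrightarrow> J = I \<or> J = carrier R)"

definition minimal_left_ideal :: "'a set \<Rightarrow> ('a, 'm) ring_scheme \<Rightarrow> bool" where
  "minimal_left_ideal I R \<longleftrightarrow> left_ideal I R \<and> I \<noteq> {\<zero>\<^bsub>R\<^esub>} \<and>
     (\<forall>J. left_ideal J R \<and> J \<subseteq> I \<longrightarrow> J = {\<zero>\<^bsub>R\<^esub>} \<or> J = I)"

definition essential_left_ideal :: "'a set \<Rightarrow> ('a, 'm) ring_scheme \<Rightarrow> bool" where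
  "essential_left_ideal I R \<longleftrightarrow> left_ideal I R \<and>
     (\<forall>J. left_ideal J R \<and> J \<noteq> {\<zero>\<^bsub>R\<^esub>} \<longrightarrow> I \<inter> J \<noteq> {\<zero>\<^bsub>R\<^esub>})"

text \<open>The intersection with the carrier matters only for the zero ring, which has no
  maximal left ideals.\<close>

definition jacobson_radical :: "('a, 'm) ring_scheme \<Rightarrow> 'a set" where
  "jacobson_radical R = carrier R \<inter> \<Inter> {I. maximal_left_ideal I R}"

definition semiprimitive :: "('a, 'm) ring_scheme \<Rightarrow> bool" where
  "semiprimitive R \<longleftrightarrow> jacobson_radical R = {\<zero>\<^bsub>R\<^esub>}"

definition sandwich :: "('a, 'm) ring_scheme \<Rightarrow> 'a \<Rightarrow> 'a \<Rightarrow> 'a set" where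
  "sandwich R x y = {x \<otimes>\<^bsub>R\<^esub> r \<otimes>\<^bsub>R\<^esub> y | r. r \<in> carrier R}"

definition NJ_reflexive :: "('a, 'm) ring_scheme \<Rightarrow> bool" where
  "NJ_reflexive R \<longleftrightarrow> (\<forall>x \<in> carrier R. \<forall>y \<in> carrier R.
     sandwich R x y \<subseteq> nilpotents R \<longrightarrow> sandwich R y x \<subseteq> jacobson_radical R)"

text \<open>The library's \<open>PIdl\<^bsub>R\<^esub> a\<close> is by definition \<open>{x \<otimes> a | x. x \<in> carrier R}\<close>, that is, the
  left ideal \<open>Ra\<close>, also when \<open>R\<close> is not commutative.\<close>

definition minimal_left_idempotents :: "('a, 'm) ring_scheme \<Rightarrow> 'a set" where
  "minimal_left_idempotents R = {e \<in> idempotents R. minimal_left_ideal (PIdl\<^bsub>R\<^esub> e) R}"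

definition left_MC2 :: "('a, 'm) ring_scheme \<Rightarrow> bool" where
  "left_MC2 R \<longleftrightarrow> (\<forall>a \<in> carrier R. \<forall>e \<in> minimal_left_idempotents R.
     sandwich R a e = {\<zero>\<^bsub>R\<^esub>} \<longrightarrow> sandwich R e a = {\<zero>\<^bsub>R\<^esub>})"

section \<open>Left modules\<close>

text \<open>The library's \<open>module\<close> locale requires a commutative ring of scalars. As there,
  the \<open>mult\<close> and \<open>one\<close> fields of the record \<open>M\<close> play no role.\<close>

locale left_module = R?: ring R + M?: abelian_group M
  for R :: "('a, 'm) ring_scheme" (structure) and M :: "('a, 'b, 'n) module_scheme" (structure) +
  assumes smult_closed [simp, intro]:
      "\<lbrakk>a \<in> carrier R; x \<in> carrier M\<rbrakk> \<Longrightarrow> a \<odot>\<^bsub>M\<^esub> x \<in> carrier M"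
    and smult_l_distr:
      "\<lbrakk>a \<in> carrier R; b \<in> carrier R; x \<in> carrier M\<rbrakk> \<Longrightarrow>
       (a \<oplus> b) \<odot>\<^bsub>M\<^esub> x = a \<odot>\<^bsub>M\<^esub> x \<oplus>\<^bsub>M\<^esub> b \<odot>\<^bsub>M\<^esub> x"
    and smult_r_distr:
      "\<lbrakk>a \<in> carrier R; x \<in> carrier M; y \<in> carrier M\<rbrakk> \<Longrightarrow>
       a \<odot>\<^bsub>M\<^esub> (x \<oplus>\<^bsub>M\<^esub> y) = a \<odot>\<^bsub>M\<^esub> x \<oplus>\<^bsub>M\<^esub> a \<odot>\<^bsub>M\<^esub> y"
    and smult_assoc1:
      "\<lbrakk>a \<in> carrier R; b \<in> carrier R; x \<in> carrier M\<rbrakk> \<Longrightarrow>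
       (a \<otimes> b) \<odot>\<^bsub>M\<^esub> x = a \<odot>\<^bsub>M\<^esub> (b \<odot>\<^bsub>M\<^esub> x)"
    and smult_one [simp]:
      "x \<in> carrier M \<Longrightarrow> \<one> \<odot>\<^bsub>M\<^esub> x = x"

definition regular_left_module :: "('a, 'm) ring_scheme \<Rightarrow> ('a, 'a) module" where
  "regular_left_module R = \<lparr>carrier = carrier R, mult = (\<otimes>\<^bsub>R\<^esub>), one = \<one>\<^bsub>R\<^esub>,
     zero = \<zero>\<^bsub>R\<^esub>, add = (\<oplus>\<^bsub>R\<^esub>), smult = (\<otimes>\<^bsub>R\<^esub>)\<rparr>"

definition left_module_hom ::
    "('a, 'm) ring_scheme \<Rightarrow> ('a, 'b, 'n) module_scheme \<Rightarrow> ('a, 'c, 'p) module_scheme \<Rightarrow> ('b \<Rightarrow> 'c) set"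
  where
  "left_module_hom R M N = {f \<in> carrier M \<rightarrow> carrier N.
     (\<forall>x \<in> carrier M. \<forall>y \<in> carrier M. f (x \<oplus>\<^bsub>M\<^esub> y) = f x \<oplus>\<^bsub>N\<^esub> f y) \<and>
     (\<forall>r \<in> carrier R. \<forall>x \<in> carrier M. f (r \<odot>\<^bsub>M\<^esub> x) = r \<odot>\<^bsub>N\<^esub> f x)}"

text \<open>The library's \<open>submodule\<close> does not assume commutativity.\<close>

definition simple_left_module :: "('a, 'm) ring_scheme \<Rightarrow> ('a, 'b, 'n) module_scheme \<Rightarrow> bool" where
  "simple_left_module R M \<longleftrightarrow> left_module R M \<and> carrier M \<noteq> {\<zero>\<^bsub>M\<^esub>} \<and>
     (\<forall>H. submodule H R M \<longrightarrow> H = {\<zero>\<^bsub>M\<^esub>} \<or> H = carrier M)"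

definition left_annihilator ::
    "('a, 'm) ring_scheme \<Rightarrow> ('a, 'b, 'n) module_scheme \<Rightarrow> 'b \<Rightarrow> 'a set" where
  "left_annihilator R M x = {r \<in> carrier R. r \<odot>\<^bsub>M\<^esub> x = \<zero>\<^bsub>M\<^esub>}"

definition singular_submodule ::
    "('a, 'm) ring_scheme \<Rightarrow> ('a, 'b, 'n) module_scheme \<Rightarrow> 'b set" where
  "singular_submodule R M = {x \<in> carrier M. essential_left_ideal (left_annihilator R M x) R}"

definition singular_left_module :: "('a, 'm) ring_scheme \<Rightarrow> ('a, 'b, 'n) module_scheme \<Rightarrow> bool" where
  "singular_left_module R M \<longleftrightarrow> left_module R M \<and> singular_submodule R M = carrier M"

definition Wnil_injective :: "('a, 'm) ring_scheme \<Rightarrow> ('a, 'b, 'n) module_scheme \<Rightarrow> bool" where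
  "Wnil_injective R M \<longleftrightarrow> left_module R M \<and>
     (\<forall>a \<in> nilpotents R. a \<noteq> \<zero>\<^bsub>R\<^esub> \<longrightarrow>
       (\<exists>k::nat. 0 < k \<and> a [^]\<^bsub>R\<^esub> k \<noteq> \<zero>\<^bsub>R\<^esub> \<and>
         (\<forall>f \<in> left_module_hom R ((regular_left_module R)\<lparr>carrier := PIdl\<^bsub>R\<^esub> (a [^]\<^bsub>R\<^esub> k)\<rparr>) M.
           \<exists>g \<in> left_module_hom R (regular_left_module R) M.
             \<forall>x \<in> PIdl\<^bsub>R\<^esub> (a [^]\<^bsub>R\<^esub> k). g x = f x)))"

text \<open>A formula of HOL cannot quantify over modules with carriers in all types. A simple
  module is isomorphic to some \<open>R/L\<close>, whose elements are sets of elements of \<open>R\<close>, so it is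
  enough to quantify over modules with carrier in \<open>'a set\<close>; the theorem
  \<open>all_simple_singular_Wnil_injectiveD\<close> below confirms this.\<close>

definition all_simple_singular_Wnil_injective :: "('a, 'm) ring_scheme \<Rightarrow> bool" where
  "all_simple_singular_Wnil_injective R \<longleftrightarrow>
     (\<forall>M :: ('a, 'a set) module. simple_left_module R M \<and> singular_left_module R M \<longrightarrow>
        Wnil_injective R M)"

lemma (in left_module) smult_zeros:
  shows "x \<in> carrier M \<Longrightarrow> \<zero> \<odot>\<^bsub>M\<^esub> x = \<zero>\<^bsub>M\<^esub>"
    and "r \<in> carrier R \<Longrightarrow> r \<odot>\<^bsub>M\<^esub> \<zero>\<^bsub>M\<^esub> = \<zero>\<^bsub>M\<^esub>"
proof -
  show "\<zero> \<odot>\<^bsub>M\<^esub> x = \<zero>\<^bsub>M\<^esub>" if "x \<in> carrier M"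
    using smult_l_distr[of \<zero> \<zero> x] that by (metis M.add.r_cancel_one' R.l_zero R.zero_closed smult_closed)
  show "r \<odot>\<^bsub>M\<^esub> \<zero>\<^bsub>M\<^esub> = \<zero>\<^bsub>M\<^esub>" if "r \<in> carrier R"
    using smult_r_distr[of r "\<zero>\<^bsub>M\<^esub>" "\<zero>\<^bsub>M\<^esub>"] that
    by (metis M.add.r_cancel_one' M.l_zero M.zero_closed smult_closed)
qed

lemma (in left_module) left_submoduleI:
  assumes sub: "H \<subseteq> carrier M" and zero: "\<zero>\<^bsub>M\<^esub> \<in> H"
    and add: "\<And>x y. \<lbrakk>x \<in> H; y \<in> H\<rbrakk> \<Longrightarrow> x \<oplus>\<^bsub>M\<^esub> y \<in> H"
    and smult: "\<And>r x. \<lbrakk>r \<in> carrier R; x \<in> H\<rbrakk> \<Longrightarrow> r \<odot>\<^bsub>M\<^esub> x \<in> H"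
  shows "submodule H R M"
proof -
  have neg: "\<ominus>\<^bsub>M\<^esub> x \<in> H" if "x \<in> H" for x
  proof -
    have x: "x \<in> carrier M" using that sub by auto
    have "(\<ominus> \<one>) \<odot>\<^bsub>M\<^esub> x \<oplus>\<^bsub>M\<^esub> x = \<zero>\<^bsub>M\<^esub>"
      using smult_l_distr[of "\<ominus> \<one>" \<one> x] x smult_zeros(1)[OF x] by (simp add: R.l_neg)
    then have "(\<ominus> \<one>) \<odot>\<^bsub>M\<^esub> x = \<ominus>\<^bsub>M\<^esub> x"
      using x by (simp add: M.minus_equality)
    then show ?thesis using smult[of "\<ominus> \<one>" x] that by simp
  qed
  show ?thesis
    by (intro submodule.intro subgroup.intro submodule_axioms.intro)
       (use assms neg in \<open>auto simp: a_inv_def\<close>)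
qed

lemma simple_left_module_copy:
  fixes R :: "('a, 'm) ring_scheme" and M :: "('a, 'b, 'n) module_scheme"
  assumes simple: "simple_left_module R M"
  obtains N :: "('a, 'a set) module" and \<phi> \<psi> where
    "simple_left_module R N" "bij_betw \<phi> (carrier M) (carrier N)"
    "\<phi> \<in> left_module_hom R M N" "\<psi> \<in> left_module_hom R N M"
    "\<And>x. x \<in> carrier M \<Longrightarrow> \<psi> (\<phi> x) = x" "\<phi> \<zero>\<^bsub>M\<^esub> = \<zero>\<^bsub>N\<^esub>"
proof -
  interpret left_module R M using simple by (simp add: simple_left_module_def)
  obtain m where m: "m \<in> carrier M" "m \<noteq> \<zero>\<^bsub>M\<^esub>"
    using simple M.zero_closed unfolding simple_left_module_def by blast
  define H where "H = (\<lambda>r. r \<odot>\<^bsub>M\<^esub> m) ` carrier R"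
  have "submodule H R M"
  proof (rule left_submoduleI)
    show "H \<subseteq> carrier M" using m by (auto simp: H_def)
    show "\<zero>\<^bsub>M\<^esub> \<in> H" using smult_zeros(1)[OF m(1)] unfolding H_def by (metis R.zero_closed imageI)
    show "x \<oplus>\<^bsub>M\<^esub> y \<in> H" if "x \<in> H" "y \<in> H" for x y
      using that m unfolding H_def by (auto simp: smult_l_distr[symmetric])
    show "r \<odot>\<^bsub>M\<^esub> x \<in> H" if "r \<in> carrier R" "x \<in> H" for r x
      using that m unfolding H_def by (auto simp: smult_assoc1[symmetric])
  qed
  moreover have "m \<in> H" using smult_one[OF m(1)] unfolding H_def by (metis R.one_closed imageI)
  ultimately have H: "H = carrier M"
    using simple m unfolding simple_left_module_def by blast
  define \<phi> where "\<phi> x = {r \<in> carrier R. r \<odot>\<^bsub>M\<^esub> m = x}" for x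
  have inj: "inj_on \<phi> (carrier M)"
  proof (rule inj_onI)
    fix x y assume "x \<in> carrier M" "y \<in> carrier M" "\<phi> x = \<phi> y"
    moreover obtain r where "r \<in> carrier R" "x = r \<odot>\<^bsub>M\<^esub> m"
      using H \<open>x \<in> carrier M\<close> unfolding H_def by auto
    ultimately show "x = y" unfolding \<phi>_def by auto
  qed
  define \<psi> where "\<psi> = inv_into (carrier M) \<phi>"
  have \<psi>[simp]: "\<psi> (\<phi> x) = x" if "x \<in> carrier M" for x
    using inj that by (simp add: \<psi>_def)
  define N :: "('a, 'a set) module" where
    "N = \<lparr>carrier = \<phi> ` carrier M, mult = \<lambda>X Y. X, one = \<phi> \<zero>\<^bsub>M\<^esub>, zero = \<phi> \<zero>\<^bsub>M\<^esub>,
          add = \<lambda>X Y. \<phi> (\<psi> X \<oplus>\<^bsub>M\<^esub> \<psi> Y), smult = \<lambda>r X. \<phi> (r \<odot>\<^bsub>M\<^esub> \<psi> X)\<rparr>"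
  have N[simp]: "carrier N = \<phi> ` carrier M" "\<zero>\<^bsub>N\<^esub> = \<phi> \<zero>\<^bsub>M\<^esub>"
      "X \<oplus>\<^bsub>N\<^esub> Y = \<phi> (\<psi> X \<oplus>\<^bsub>M\<^esub> \<psi> Y)" "r \<odot>\<^bsub>N\<^esub> X = \<phi> (r \<odot>\<^bsub>M\<^esub> \<psi> X)" for X Y r
    by (simp_all add: N_def)
  have "abelian_group N"
  proof (rule abelian_groupI)
    show "\<exists>Y \<in> carrier N. Y \<oplus>\<^bsub>N\<^esub> X = \<zero>\<^bsub>N\<^esub>" if "X \<in> carrier N" for X
      using that by (auto intro!: bexI[of _ "\<ominus>\<^bsub>M\<^esub> \<psi> X"] simp: M.l_neg)
  qed (auto simp: M.a_ac)
  then interpret N: left_module R N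
    by (intro left_module.intro left_module_axioms.intro R.ring_axioms)
       (auto simp: smult_l_distr smult_r_distr smult_assoc1)
  have "simple_left_module R N"
    unfolding simple_left_module_def
  proof (intro conjI allI impI N.left_module_axioms)
    show "carrier N \<noteq> {\<zero>\<^bsub>N\<^esub>}"
      using m inj M.zero_closed by (auto dest: inj_onD)
    fix K assume K: "submodule K R N"
    have Ksub: "K \<subseteq> \<phi> ` carrier M" and Kz: "\<phi> \<zero>\<^bsub>M\<^esub> \<in> K"
      and Ka: "\<And>X Y. \<lbrakk>X \<in> K; Y \<in> K\<rbrakk> \<Longrightarrow> \<phi> (\<psi> X \<oplus>\<^bsub>M\<^esub> \<psi> Y) \<in> K"
      using subgroup.subset[OF submodule.axioms(1)[OF K]]
        subgroup.one_closed[OF submodule.axioms(1)[OF K]]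
        subgroup.m_closed[OF submodule.axioms(1)[OF K]] by auto
    have Ks: "\<And>r X. \<lbrakk>r \<in> carrier R; X \<in> K\<rbrakk> \<Longrightarrow> \<phi> (r \<odot>\<^bsub>M\<^esub> \<psi> X) \<in> K"
      using submodule.smult_closed[OF K] by simp
    define L where "L = {x \<in> carrier M. \<phi> x \<in> K}"
    have "submodule L R M"
    proof (rule left_submoduleI)
      show "x \<oplus>\<^bsub>M\<^esub> y \<in> L" if "x \<in> L" "y \<in> L" for x y
        using that Ka[of "\<phi> x" "\<phi> y"] by (auto simp: L_def)
      show "r \<odot>\<^bsub>M\<^esub> x \<in> L" if "r \<in> carrier R" "x \<in> L" for r x
        using that Ks[of r "\<phi> x"] by (auto simp: L_def)
    qed (use Kz in \<open>auto simp: L_def\<close>)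
    then have "L = {\<zero>\<^bsub>M\<^esub>} \<or> L = carrier M"
      using simple unfolding simple_left_module_def by blast
    moreover have "K = \<phi> ` L" using Ksub by (auto simp: L_def)
    ultimately show "K = {\<zero>\<^bsub>N\<^esub>} \<or> K = carrier N" by auto
  qed
  then show ?thesis
    by (rule that[of N \<phi> \<psi>])
       (use inj in \<open>auto simp: bij_betw_def left_module_hom_def\<close>)
qed

theorem all_simple_singular_Wnil_injectiveD:
  fixes R :: "('a, 'm) ring_scheme" and M :: "('a, 'b, 'n) module_scheme"
  assumes all: "all_simple_singular_Wnil_injective R"
    and simple: "simple_left_module R M" and singular: "singular_left_module R M"
  shows "Wnil_injective R M"
proof -
  obtain N :: "('a, 'a set) module" and \<phi> \<psi> where
    N: "simple_left_module R N" "bij_betw \<phi> (carrier M) (carrier N)"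
      "\<phi> \<in> left_module_hom R M N" "\<psi> \<in> left_module_hom R N M"
      "\<And>x. x \<in> carrier M \<Longrightarrow> \<psi> (\<phi> x) = x" "\<phi> \<zero>\<^bsub>M\<^esub> = \<zero>\<^bsub>N\<^esub>"
    using simple_left_module_copy[OF simple] by blast
  interpret M: left_module R M using simple by (simp add: simple_left_module_def)
  have ann: "left_annihilator R N (\<phi> x) = left_annihilator R M x" if x: "x \<in> carrier M" for x
  proof -
    have "r \<odot>\<^bsub>N\<^esub> \<phi> x = \<zero>\<^bsub>N\<^esub> \<longleftrightarrow> r \<odot>\<^bsub>M\<^esub> x = \<zero>\<^bsub>M\<^esub>" if r: "r \<in> carrier R" for r
    proof -
      have "r \<odot>\<^bsub>N\<^esub> \<phi> x = \<phi> (r \<odot>\<^bsub>M\<^esub> x)" using N(3) x r by (simp add: left_module_hom_def)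
      then show ?thesis using N(5,6) x r by (metis M.smult_closed M.M.zero_closed)
    qed
    then show ?thesis by (auto simp: left_annihilator_def)
  qed
  have "essential_left_ideal (left_annihilator R N y) R" if y: "y \<in> carrier N" for y
  proof -
    obtain x where "x \<in> carrier M" "y = \<phi> x"
      using bij_betw_imp_surj_on[OF N(2)] y by auto
    with singular ann show ?thesis
      unfolding singular_left_module_def singular_submodule_def by auto
  qed
  then have "singular_left_module R N"
    using N(1) unfolding singular_left_module_def singular_submodule_def simple_left_module_def
    by blast
  with all N(1) have W: "Wnil_injective R N"
    unfolding all_simple_singular_Wnil_injective_def by blast
  have comp: "h \<circ> f \<in> left_module_hom R A C"
    if "f \<in> left_module_hom R A B" "h \<in> left_module_hom R B C"
    for A :: "('a, 'a) module" and B :: "('a, 'x, 'y) module_scheme"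
      and C :: "('a, 'z, 'w) module_scheme" and f h
    using that by (auto simp: left_module_hom_def Pi_iff)
  show ?thesis
    unfolding Wnil_injective_def
  proof (intro conjI ballI impI M.left_module_axioms)
    fix a assume "a \<in> nilpotents R" "a \<noteq> \<zero>\<^bsub>R\<^esub>"
    then have "\<exists>k::nat. 0 < k \<and> a [^]\<^bsub>R\<^esub> k \<noteq> \<zero>\<^bsub>R\<^esub> \<and>
         (\<forall>f \<in> left_module_hom R ((regular_left_module R)\<lparr>carrier := PIdl\<^bsub>R\<^esub> (a [^]\<^bsub>R\<^esub> k)\<rparr>) N.
           \<exists>g \<in> left_module_hom R (regular_left_module R) N.
             \<forall>x \<in> PIdl\<^bsub>R\<^esub> (a [^]\<^bsub>R\<^esub> k). g x = f x)"
      using W by (simp add: Wnil_injective_def)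
    then obtain k :: nat where k: "0 < k" "a [^]\<^bsub>R\<^esub> k \<noteq> \<zero>\<^bsub>R\<^esub>"
      and ext: "\<forall>f \<in> left_module_hom R ((regular_left_module R)\<lparr>carrier := PIdl\<^bsub>R\<^esub> (a [^]\<^bsub>R\<^esub> k)\<rparr>) N.
           \<exists>g \<in> left_module_hom R (regular_left_module R) N.
             \<forall>x \<in> PIdl\<^bsub>R\<^esub> (a [^]\<^bsub>R\<^esub> k). g x = f x"
      by (elim exE conjE)
    show "\<exists>k::nat. 0 < k \<and> a [^]\<^bsub>R\<^esub> k \<noteq> \<zero>\<^bsub>R\<^esub> \<and>
         (\<forall>f \<in> left_module_hom R ((regular_left_module R)\<lparr>carrier := PIdl\<^bsub>R\<^esub> (a [^]\<^bsub>R\<^esub> k)\<rparr>) M.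
           \<exists>g \<in> left_module_hom R (regular_left_module R) M.
             \<forall>x \<in> PIdl\<^bsub>R\<^esub> (a [^]\<^bsub>R\<^esub> k). g x = f x)"
    proof (intro exI[of _ k] conjI k ballI)
      fix f assume f: "f \<in> left_module_hom R ((regular_left_module R)\<lparr>carrier := PIdl\<^bsub>R\<^esub> (a [^]\<^bsub>R\<^esub> k)\<rparr>) M"
      let ?I = "PIdl\<^bsub>R\<^esub> (a [^]\<^bsub>R\<^esub> k)"
      obtain g where g: "g \<in> left_module_hom R (regular_left_module R) N"
        "\<forall>x \<in> ?I. g x = (\<phi> \<circ> f) x"
        using bspec[OF ext comp[OF f N(3)]] by (elim bexE)
      have "\<forall>x \<in> ?I. (\<psi> \<circ> g) x = f x"
      proof
        fix x assume x: "x \<in> ?I"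
        have "f \<in> ?I \<rightarrow> carrier M" using f by (simp add: left_module_hom_def)
        then have "f x \<in> carrier M" using x by (rule funcset_mem)
        with g(2) N(5) x show "(\<psi> \<circ> g) x = f x" by simp
      qed
      then show "\<exists>g \<in> left_module_hom R (regular_left_module R) M. \<forall>x \<in> ?I. g x = f x"
        by (rule bexI[of _ "\<psi> \<circ> g", OF _ comp[OF g(1) N(4)]])
    qed
  qed
qed

end

theory Submission
  imports Defs
begin

text \<open>A ring is reduced as soon as it has no nonzero \<open>a\<close> with \<open>a\<^sup>2 = 0\<close>, so fix such an
  \<open>a\<close>. Each \<open>ara\<close> then squares to zero, hence \<open>aRa \<subseteq> N(R)\<close>, and NJ-reflexivity with
  \<open>x = y = a\<close> gives \<open>aRa \<subseteq> J(R)\<close>. The radical is a semiprime ideal, so \<open>a \<in> J(R)\<close>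
  (lemma \<open>square_zero_mem_jacobson_radical\<close>). If \<open>R\<close> is semiprimitive, this says \<open>a = 0\<close>.

  Under the second condition suppose \<open>a \<noteq> 0\<close>, and let \<open>M\<close> be a maximal left ideal that
  contains the left annihilator of \<open>a\<close>. If \<open>M\<close> were not essential, it would be a direct
  summand, \<open>M = {x. xe = 0}\<close> for an idempotent \<open>e\<close> with \<open>Re\<close> a minimal left ideal. As
  \<open>J(R)\<close> kills simple modules, \<open>aRe = 0\<close>, so \<open>eRa = 0\<close> by MC2; then \<open>e\<close> annihilates
  \<open>a\<close>, so \<open>e \<in> M\<close>, that is \<open>e = e\<^sup>2 = 0\<close>, which is absurd
  (lemma \<open>maximal_left_ideal_essential_if_MC2\<close>).
  Hence \<open>R/M\<close> is simple and singular, and therefore Wnil-injective. The only nonzero positive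
  power of \<open>a\<close> is \<open>a\<close> itself, so the homomorphism \<open>ra \<mapsto> r + M\<close> on \<open>Ra\<close> extends to
  \<open>R\<close>; evaluating the extension at \<open>a = a \<cdot> 1\<close> gives \<open>1 - ac \<in> M\<close> for some \<open>c\<close>
  (lemma \<open>one_minus_mem_if_quotient_Wnil_injective\<close>). But \<open>ac \<in> J(R) \<subseteq> M\<close>, which forces
  \<open>1 \<in> M\<close>.\<close>

section \<open>Left ideals\<close>

lemma (in abelian_group) add_minus_cancel_left:
  "\<lbrakk>x \<in> carrier G; y \<in> carrier G\<rbrakk> \<Longrightarrow> (x \<oplus> y) \<ominus> x = y"
  by (simp add: minus_eq a_comm[of x y] a_assoc r_neg)

lemma (in ring) left_idealI:
  assumes sub: "I \<subseteq> carrier R" and zero: "\<zero> \<in> I"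
    and add: "\<And>x y. \<lbrakk>x \<in> I; y \<in> I\<rbrakk> \<Longrightarrow> x \<oplus> y \<in> I"
    and mult: "\<And>r x. \<lbrakk>r \<in> carrier R; x \<in> I\<rbrakk> \<Longrightarrow> r \<otimes> x \<in> I"
  shows "left_ideal I R"
proof -
  have neg: "\<ominus> x \<in> I" if "x \<in> I" for x
    using mult[of "\<ominus> \<one>" x] that sub by (auto simp: l_minus)
  have "subgroup I (add_monoid R)"
    by (rule add.subgroupI) (use assms neg in \<open>auto simp: a_inv_def[symmetric]\<close>)
  then show ?thesis
    by (intro left_ideal.intro additive_subgroup.intro left_ideal_axioms.intro ring_axioms)
       (use mult in auto)
qed

lemma (in left_ideal) minus_closed: "\<lbrakk>x \<in> I; y \<in> I\<rbrakk> \<Longrightarrow> x \<ominus> y \<in> I"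
  by (simp add: minus_eq)

lemma (in left_ideal) eq_carrier_if_one_mem: "\<one> \<in> I \<Longrightarrow> I = carrier R"
  using l_closed[of \<one>] a_subset by auto

lemma (in ring) PIdl_left_ideal:
  assumes a: "a \<in> carrier R"
  shows "left_ideal (PIdl a) R"
proof (rule left_idealI)
  show "PIdl a \<subseteq> carrier R" using a by (auto simp: cgenideal_def)
  show "\<zero> \<in> PIdl a" using a unfolding cgenideal_def
    by (metis (mono_tags, lifting) l_null mem_Collect_eq zero_closed)
  show "x \<oplus> y \<in> PIdl a" if "x \<in> PIdl a" "y \<in> PIdl a" for x y
    using that a unfolding cgenideal_def by (auto simp: l_distr[symmetric])
  show "r \<otimes> x \<in> PIdl a" if "r \<in> carrier R" "x \<in> PIdl a" for r x
    using that a unfolding cgenideal_def by (auto simp: m_assoc[symmetric])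
qed

lemma (in ring) mem_PIdl: "a \<in> carrier R \<Longrightarrow> a \<in> PIdl a"
  unfolding cgenideal_def using l_one[of a] by (metis (mono_tags, lifting) mem_Collect_eq one_closed)

lemma (in ring) left_ideal_colon:
  assumes "left_ideal I R" and x: "x \<in> carrier R"
  shows "left_ideal {r \<in> carrier R. r \<otimes> x \<in> I} R"
proof -
  interpret I: left_ideal I R by fact
  show ?thesis
    by (rule left_idealI) (use x in \<open>auto simp: l_distr m_assoc I.l_closed\<close>)
qed

lemma (in ring) left_ideal_zero: "left_ideal {\<zero>} R"
  by (rule left_idealI) auto

lemma (in ring) left_ideal_sum:
  assumes "left_ideal I R" "left_ideal J R"
  shows "left_ideal {i \<oplus> j | i j. i \<in> I \<and> j \<in> J} R"
proof -
  interpret I: left_ideal I R by fact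
  interpret J: left_ideal J R by fact
  show ?thesis
  proof (rule left_idealI)
    show "\<zero> \<in> {i \<oplus> j | i j. i \<in> I \<and> j \<in> J}"
      by (rule CollectI, rule exI[of _ \<zero>], rule exI[of _ \<zero>]) simp
    show "x \<oplus> y \<in> {i \<oplus> j | i j. i \<in> I \<and> j \<in> J}"
      if x: "x \<in> {i \<oplus> j | i j. i \<in> I \<and> j \<in> J}" and y: "y \<in> {i \<oplus> j | i j. i \<in> I \<and> j \<in> J}" for x y
    proof -
      obtain i j i' j' where *: "i \<in> I" "j \<in> J" "i' \<in> I" "j' \<in> J" "x = i \<oplus> j" "y = i' \<oplus> j'"
        using x y by auto
      then have "x \<oplus> y = (i \<oplus> i') \<oplus> (j \<oplus> j')" by (simp add: a_ac)
      then show ?thesis using * by blast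
    qed
    show "r \<otimes> x \<in> {i \<oplus> j | i j. i \<in> I \<and> j \<in> J}"
      if r: "r \<in> carrier R" and x: "x \<in> {i \<oplus> j | i j. i \<in> I \<and> j \<in> J}" for r x
    proof -
      obtain i j where *: "i \<in> I" "j \<in> J" "x = i \<oplus> j"
        using x by auto
      then have "r \<otimes> x = (r \<otimes> i) \<oplus> (r \<otimes> j)" using r by (simp add: r_distr)
      then show ?thesis using * r I.l_closed J.l_closed by blast
    qed
  qed auto
qed

section \<open>The quotient by a left ideal\<close>

text \<open>The union in \<open>smult\<close> is over cosets that all coincide; it avoids choosing a
  representative of \<open>X\<close>. The fields \<open>mult\<close> and \<open>one\<close> carry dummy values, because the
  record for modules extends the one for rings.\<close>

definition quotient_left_module :: "('a, 'm) ring_scheme \<Rightarrow> 'a set \<Rightarrow> ('a, 'a set) module" where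
  "quotient_left_module R I = \<lparr>carrier = a_rcosets\<^bsub>R\<^esub> I, mult = \<lambda>X Y. X, one = I, zero = I,
     add = (<+>\<^bsub>R\<^esub>), smult = \<lambda>r X. \<Union>x \<in> X. I +>\<^bsub>R\<^esub> r \<otimes>\<^bsub>R\<^esub> x\<rparr>"

lemma quotient_left_module_simps [simp]:
  "carrier (quotient_left_module R I) = a_rcosets\<^bsub>R\<^esub> I"
  "\<zero>\<^bsub>quotient_left_module R I\<^esub> = I"
  "X \<oplus>\<^bsub>quotient_left_module R I\<^esub> Y = X <+>\<^bsub>R\<^esub> Y"
  by (simp_all add: quotient_left_module_def)

lemma (in left_ideal) abelian_subgroup: "abelian_subgroup I R"
  by (rule abelian_subgroupI3) (rule additive_subgroup_axioms, rule is_abelian_group)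

lemma (in ring) rcosets_eq: "a_rcosets I = (\<lambda>x. I +> x) ` carrier R"
  by (auto simp: A_RCOSETS_def')

lemma (in ring) coset_sum:
  assumes "left_ideal I R" and "x \<in> carrier R" "y \<in> carrier R"
  shows "(I +> x) <+> (I +> y) = I +> (x \<oplus> y)"
  using assms by (intro abelian_subgroup.a_rcos_sum left_ideal.abelian_subgroup)

lemma (in ring) coset_eq_iff:
  assumes I: "left_ideal I R" and "x \<in> carrier R" "y \<in> carrier R"
  shows "I +> x = I +> y \<longleftrightarrow> x \<ominus> y \<in> I"
proof -
  interpret abelian_subgroup I R by (rule left_ideal.abelian_subgroup[OF I])
  show ?thesis
    using assms a_rcos_module_minus[OF ring_axioms, of y x] a_repr_independence'[of x y] a_rcos_self[of x]
    by auto
qed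

lemma (in ring) coset_eq_self_iff:
  assumes I: "left_ideal I R" and x: "x \<in> carrier R"
  shows "I +> x = I \<longleftrightarrow> x \<in> I"
proof -
  interpret abelian_subgroup I R by (rule left_ideal.abelian_subgroup[OF I])
  show ?thesis
    using x a_coset_join1[OF _ _ a_subgroup] a_coset_join2[OF _ a_subgroup] by auto
qed

lemma (in ring) quotient_smult:
  assumes I: "left_ideal I R" and r: "r \<in> carrier R" and x: "x \<in> carrier R"
  shows "r \<odot>\<^bsub>quotient_left_module R I\<^esub> (I +> x) = I +> (r \<otimes> x)"
proof -
  interpret I: left_ideal I R by (rule I)
  interpret abelian_subgroup I R by (rule I.abelian_subgroup)
  have "I +> r \<otimes> y = I +> r \<otimes> x" if y: "y \<in> I +> x" for y
  proof -
    have yc: "y \<in> carrier R" using y x a_r_coset_subset_G[OF I.a_subset] by auto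
    have "y \<ominus> x \<in> I" using y a_rcos_module_minus[OF ring_axioms x yc] by simp
    then have "r \<otimes> (y \<ominus> x) \<in> I" using r I.l_closed by simp
    then show ?thesis
      using r x yc by (simp add: coset_eq_iff[OF I] r_distr minus_eq r_minus)
  qed
  then have "(\<Union>y \<in> I +> x. I +> r \<otimes> y) = (\<Union>y \<in> I +> x. I +> r \<otimes> x)"
    by (intro SUP_cong refl)
  also have "\<dots> = I +> r \<otimes> x" using a_rcos_self[OF x] by auto
  finally show ?thesis by (simp add: quotient_left_module_def)
qed

lemma (in ring) quotient_left_module:
  assumes I: "left_ideal I R"
  shows "left_module R (quotient_left_module R I)"
proof -
  interpret abelian_subgroup I R by (rule left_ideal.abelian_subgroup[OF I])
  let ?Q = "quotient_left_module R I"
  have zero: "I +> \<zero> = I" by (simp add: coset_eq_self_iff[OF I])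
  have "abelian_group ?Q"
  proof (rule abelian_groupI)
    show "\<exists>Y \<in> carrier ?Q. Y \<oplus>\<^bsub>?Q\<^esub> X = \<zero>\<^bsub>?Q\<^esub>" if X: "X \<in> carrier ?Q" for X
    proof -
      obtain x where x: "x \<in> carrier R" "X = I +> x" using X by (auto simp: rcosets_eq)
      have "(I +> \<ominus> x) <+> (I +> x) = I" using x zero by (simp add: a_rcos_sum l_neg)
      then show ?thesis using x by (auto simp: rcosets_eq)
    qed
    show "\<zero>\<^bsub>?Q\<^esub> \<in> carrier ?Q" using zero by (auto simp: rcosets_eq)
  qed (auto simp: rcosets_add_eq, auto simp: rcosets_eq a_rcos_sum a_ac)
  then show ?thesis
    by (intro left_module.intro left_module_axioms.intro ring_axioms)
       (auto simp: rcosets_eq quotient_smult[OF I] a_rcos_sum l_distr r_distr m_assoc)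
qed

text \<open>This is the half of the correspondence theorem that makes \<open>R/M\<close> simple when \<open>M\<close> is
  maximal: a submodule is determined by its preimage, a left ideal that contains \<open>I\<close>.\<close>

lemma (in ring) quotient_submodule_preimage:
  assumes I: "left_ideal I R" and H: "submodule H R (quotient_left_module R I)"
  shows "left_ideal {x \<in> carrier R. I +> x \<in> H} R" and "I \<subseteq> {x \<in> carrier R. I +> x \<in> H}"
    and "H = (\<lambda>x. I +> x) ` {x \<in> carrier R. I +> x \<in> H}"
proof -
  note sub = submodule.axioms(1)[OF H]
  have zero: "I \<in> H" using subgroup.one_closed[OF sub] by simp
  have add: "X <+> Y \<in> H" if "X \<in> H" "Y \<in> H" for X Y
    using subgroup.m_closed[OF sub that] by simp
  show "left_ideal {x \<in> carrier R. I +> x \<in> H} R"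
  proof (rule left_idealI)
    show "\<zero> \<in> {x \<in> carrier R. I +> x \<in> H}"
      using zero coset_eq_self_iff[OF I zero_closed] additive_subgroup.zero_closed[OF left_ideal.axioms(1)[OF I]]
      by simp
    show "x \<oplus> y \<in> {x \<in> carrier R. I +> x \<in> H}"
      if "x \<in> {x \<in> carrier R. I +> x \<in> H}" "y \<in> {x \<in> carrier R. I +> x \<in> H}" for x y
      using that add[of "I +> x" "I +> y"] by (simp add: coset_sum[OF I])
    show "r \<otimes> x \<in> {x \<in> carrier R. I +> x \<in> H}"
      if "r \<in> carrier R" "x \<in> {x \<in> carrier R. I +> x \<in> H}" for r x
      using that submodule.smult_closed[OF H, of r "I +> x"] by (simp add: quotient_smult[OF I])
  qed auto
  show "I \<subseteq> {x \<in> carrier R. I +> x \<in> H}"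
  proof
    fix x assume x: "x \<in> I"
    have xc: "x \<in> carrier R" by (rule additive_subgroup.a_Hcarr[OF left_ideal.axioms(1)[OF I] x])
    then have "I +> x = I" using x by (simp add: coset_eq_self_iff[OF I])
    then show "x \<in> {x \<in> carrier R. I +> x \<in> H}" using zero xc by simp
  qed
  show "H = (\<lambda>x. I +> x) ` {x \<in> carrier R. I +> x \<in> H}"
    using subgroup.subset[OF sub] by (auto simp: rcosets_eq)
qed

lemma (in ring) quotient_simple:
  assumes M: "maximal_left_ideal M R"
  shows "simple_left_module R (quotient_left_module R M)"
proof -
  let ?Q = "quotient_left_module R M"
  have MI: "left_ideal M R" and proper: "M \<noteq> carrier R"
    using M by (simp_all add: maximal_left_ideal_def)
  have "\<one> \<notin> M" using proper left_ideal.eq_carrier_if_one_mem[OF MI] by blast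
  then have "M +> \<one> \<noteq> M" by (simp add: coset_eq_self_iff[OF MI])
  then have nonzero: "a_rcosets M \<noteq> {M}" unfolding rcosets_eq by blast
  have "H = {M} \<or> H = a_rcosets M" if sub: "submodule H R ?Q" for H
  proof -
    let ?P = "{x \<in> carrier R. M +> x \<in> H}"
    note P = quotient_submodule_preimage[OF MI sub]
    have "?P = M \<or> ?P = carrier R"
      using M P(1,2) unfolding maximal_left_ideal_def by blast
    then show ?thesis
    proof
      assume eq: "?P = M"
      have "M +> x = M" if "x \<in> ?P" for x
        using that eq coset_eq_self_iff[OF MI, of x] by blast
      then have "H \<subseteq> {M}" by (subst P(3)) blast
      moreover have "M \<in> H" using subgroup.one_closed[OF submodule.axioms(1)[OF sub]] by simp
      ultimately show ?thesis by blast
    next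
      assume "?P = carrier R"
      then show ?thesis using P(3) by (simp add: rcosets_eq)
    qed
  qed
  then show ?thesis
    using quotient_left_module[OF MI] nonzero by (simp add: simple_left_module_def)
qed

text \<open>The annihilator of \<open>x + M\<close> is the left ideal \<open>(M : x) = {r. rx \<in> M}\<close>. It meets a nonzero left ideal \<open>J\<close>
  nontrivially: either \<open>Jx = 0\<close> and \<open>J \<subseteq> (M : x)\<close>, or \<open>Jx\<close> is a nonzero left ideal and
  \<open>M\<close> contains some \<open>jx \<noteq> 0\<close>.\<close>

lemma (in ring) quotient_singular:
  assumes M: "essential_left_ideal M R"
  shows "singular_left_module R (quotient_left_module R M)"
proof -
  let ?Q = "quotient_left_module R M"
  interpret M: left_ideal M R using M by (simp add: essential_left_ideal_def)
  have "essential_left_ideal (left_annihilator R ?Q (M +> x)) R" if x: "x \<in> carrier R" for x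
  proof -
    let ?C = "{r \<in> carrier R. r \<otimes> x \<in> M}"
    have ne: "\<exists>y \<in> A. y \<noteq> z" if "z \<in> A" "A \<noteq> {z}" for A and z :: 'a
      using that by blast
    have ann: "left_annihilator R ?Q (M +> x) = ?C"
      unfolding left_annihilator_def
    proof (intro Collect_cong conj_cong refl)
      show "r \<odot>\<^bsub>?Q\<^esub> (M +> x) = \<zero>\<^bsub>?Q\<^esub> \<longleftrightarrow> r \<otimes> x \<in> M" if r: "r \<in> carrier R" for r
        using coset_eq_self_iff[OF M.left_ideal_axioms, of "r \<otimes> x"] r x
        by (simp add: quotient_smult[OF M.left_ideal_axioms])
    qed
    have C: "left_ideal ?C R" by (rule left_ideal_colon[OF M.left_ideal_axioms x])
    have "?C \<inter> J \<noteq> {\<zero>}" if J: "left_ideal J R" "J \<noteq> {\<zero>}" for J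
    proof -
      interpret J: left_ideal J R by fact
      have Jx: "left_ideal ((\<lambda>j. j \<otimes> x) ` J) R"
      proof (rule left_idealI)
        show "\<zero> \<in> (\<lambda>j. j \<otimes> x) ` J" using x J.zero_closed l_null[OF x] by (metis imageI)
        show "y \<oplus> z \<in> (\<lambda>j. j \<otimes> x) ` J" if "y \<in> (\<lambda>j. j \<otimes> x) ` J" "z \<in> (\<lambda>j. j \<otimes> x) ` J" for y z
          using that x by (auto simp: l_distr[symmetric])
        show "r \<otimes> y \<in> (\<lambda>j. j \<otimes> x) ` J" if "r \<in> carrier R" "y \<in> (\<lambda>j. j \<otimes> x) ` J" for r y
          using that x J.l_closed by (auto simp: m_assoc[symmetric])
      qed (use x in auto)
      show ?thesis
      proof (cases "(\<lambda>j. j \<otimes> x) ` J = {\<zero>}")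
        case True
        have "j \<otimes> x \<in> M" if "j \<in> J" for j
        proof -
          have "j \<otimes> x \<in> (\<lambda>j. j \<otimes> x) ` J" using that by (rule imageI)
          then have "j \<otimes> x = \<zero>" unfolding True by (rule singletonD)
          then show ?thesis by simp
        qed
        then have "J \<subseteq> ?C" by auto
        then show ?thesis using J(2) by (simp add: Int_absorb1)
      next
        case False
        then have "M \<inter> (\<lambda>j. j \<otimes> x) ` J \<noteq> {\<zero>}" using M Jx by (simp add: essential_left_ideal_def)
        moreover have "\<zero> \<in> M \<inter> (\<lambda>j. j \<otimes> x) ` J"
          using additive_subgroup.zero_closed[OF left_ideal.axioms(1)[OF Jx]] by simp
        ultimately obtain y where y: "y \<in> M \<inter> (\<lambda>j. j \<otimes> x) ` J" "y \<noteq> \<zero>"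
          using ne by meson
        from y(1) have "y \<in> M" by (rule IntD1)
        from y(1) have "y \<in> (\<lambda>j. j \<otimes> x) ` J" by (rule IntD2)
        then obtain j where j: "j \<in> J" "y = j \<otimes> x" by (elim imageE)
        then have "j \<in> ?C" using \<open>y \<in> M\<close> by simp
        moreover have "j \<noteq> \<zero>" using j(2) y(2) x by auto
        ultimately show ?thesis using j(1) by (metis IntI singletonD)
      qed
    qed
    then show ?thesis using C unfolding ann essential_left_ideal_def by blast
  qed
  then show ?thesis
    using quotient_left_module[OF M.left_ideal_axioms]
    by (auto simp: singular_left_module_def singular_submodule_def rcosets_eq)
qed

text \<open>The hypothesis on the annihilator makes \<open>ra \<mapsto> r + I\<close> well defined on \<open>Ra\<close>. A
  homomorphism on \<open>R\<close> is right multiplication by its value \<open>c + I\<close> at \<open>1\<close>, so an extension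
  sends \<open>a\<close> both to \<open>1 + I\<close> and to \<open>ac + I\<close>.\<close>

lemma (in ring) one_minus_mem_if_quotient_Wnil_injective:
  assumes "left_ideal I R" and W: "Wnil_injective R (quotient_left_module R I)"
    and a: "a \<in> carrier R" "a \<otimes> a = \<zero>" "a \<noteq> \<zero>"
    and ann: "{r \<in> carrier R. r \<otimes> a = \<zero>} \<subseteq> I"
  obtains c where "c \<in> carrier R" "\<one> \<ominus> a \<otimes> c \<in> I"
proof -
  let ?Q = "quotient_left_module R I"
  interpret I: left_ideal I R by fact
  have a2: "a [^] (2::nat) = \<zero>" using a by (simp add: numeral_2_eq_2)
  have pow: "a [^] k = \<zero>" if "2 \<le> k" for k :: nat
  proof -
    obtain j where "k = 2 + j" using le_Suc_ex \<open>2 \<le> k\<close> by blast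
    then have "a [^] k = a [^] (2::nat) \<otimes> a [^] j" using nat_pow_mult[OF a(1), of 2 j] by metis
    then show ?thesis using a a2 by simp
  qed
  have "a \<in> nilpotents R" using a a2 by (auto simp: nilpotents_def intro: exI[of _ 2])
  then obtain k :: nat where k: "0 < k" "a [^] k \<noteq> \<zero>"
      and ext: "\<forall>f \<in> left_module_hom R ((regular_left_module R)\<lparr>carrier := PIdl (a [^] k)\<rparr>) ?Q.
           \<exists>g \<in> left_module_hom R (regular_left_module R) ?Q. \<forall>x \<in> PIdl (a [^] k). g x = f x"
    using W a(3) unfolding Wnil_injective_def by blast
  have "k = 1" using k pow[of k] by (cases "2 \<le> k") auto
  then have ak: "a [^] k = a" using a by simp
  define f where "f y = I +> (SOME r. r \<in> carrier R \<and> r \<otimes> a = y)" for y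
  have f: "f (r \<otimes> a) = I +> r" if r: "r \<in> carrier R" for r
  proof -
    define s where "s = (SOME s. s \<in> carrier R \<and> s \<otimes> a = r \<otimes> a)"
    have s: "s \<in> carrier R \<and> s \<otimes> a = r \<otimes> a"
      unfolding s_def by (rule someI[of _ r]) (use r in simp)
    then have "(s \<ominus> r) \<otimes> a = \<zero>" using r a by (simp add: minus_eq l_distr l_minus r_neg)
    then have "s \<ominus> r \<in> I" using ann r s by auto
    then show ?thesis using r s by (simp add: f_def s_def[symmetric] coset_eq_iff[OF I.left_ideal_axioms])
  qed
  have "f \<in> left_module_hom R ((regular_left_module R)\<lparr>carrier := PIdl a\<rparr>) ?Q"
    using a(1) by (auto simp: left_module_hom_def regular_left_module_def cgenideal_def f
        rcosets_eq l_distr[symmetric] m_assoc[symmetric] coset_sum[OF I.left_ideal_axioms]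
        quotient_smult[OF I.left_ideal_axioms])
  then obtain g where g: "g \<in> left_module_hom R (regular_left_module R) ?Q"
      and gf: "\<forall>x \<in> PIdl a. g x = f x"
    using ext unfolding ak by blast
  have "g \<one> \<in> carrier ?Q"
    using g by (auto simp: left_module_hom_def regular_left_module_def)
  then obtain c where c: "c \<in> carrier R" "g \<one> = I +> c" by (auto simp: rcosets_eq)
  have "I +> \<one> = g a"
    using gf mem_PIdl[OF a(1)] f[of \<one>] a by simp
  also have "\<dots> = g (a \<otimes> \<one>)" using a by simp
  also have "\<dots> = a \<odot>\<^bsub>?Q\<^esub> g \<one>"
  proof -
    have "g (r \<otimes> x) = r \<odot>\<^bsub>?Q\<^esub> g x" if "r \<in> carrier R" "x \<in> carrier R" for r x
      using g that by (simp add: left_module_hom_def regular_left_module_def)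
    from this[OF a(1) one_closed] show ?thesis .
  qed
  also have "\<dots> = I +> (a \<otimes> c)" using a c by (simp add: quotient_smult[OF I.left_ideal_axioms])
  finally have "\<one> \<ominus> a \<otimes> c \<in> I" using a c by (simp add: coset_eq_iff[OF I.left_ideal_axioms])
  then show ?thesis using that c by blast
qed

section \<open>Maximal left ideals and the Jacobson radical\<close>

text \<open>A left ideal is proper exactly when it omits \<open>\<one>\<close>, and omitting \<open>\<one>\<close> passes to unions of
  chains, so Zorn's lemma applies.\<close>

lemma (in ring) maximal_left_ideal_exists:
  assumes "left_ideal I R" and one: "\<one> \<notin> I"
  obtains M where "maximal_left_ideal M R" "I \<subseteq> M"
proof -
  define A where "A = {J. left_ideal J R \<and> I \<subseteq> J \<and> \<one> \<notin> J}"
  have "\<exists>M \<in> A. \<forall>J \<in> A. M \<subseteq> J \<longrightarrow> J = M"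
  proof (rule subset_Zorn_nonempty)
    show "A \<noteq> {}" using assms by (auto simp: A_def)
    fix C assume ne: "C \<noteq> {}" and chain: "subset.chain A C"
    have CA: "C \<subseteq> A" and lin: "\<And>X Y. \<lbrakk>X \<in> C; Y \<in> C\<rbrakk> \<Longrightarrow> X \<subseteq> Y \<or> Y \<subseteq> X"
      using chain by (auto simp: subset_chain_def)
    have li: "left_ideal X R" if "X \<in> C" for X
      using that CA by (auto simp: A_def)
    have add_sub: "additive_subgroup X R" if "X \<in> C" for X
      using li[OF that] by (simp add: left_ideal_def)
    have "left_ideal (\<Union>C) R"
    proof (rule left_idealI)
      show "\<Union>C \<subseteq> carrier R" using additive_subgroup.a_subset[OF add_sub] by blast
      show "\<zero> \<in> \<Union>C" using ne additive_subgroup.zero_closed[OF add_sub] by blast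
      show "x \<oplus> y \<in> \<Union>C" if "x \<in> \<Union>C" "y \<in> \<Union>C" for x y
      proof -
        obtain X Y where XY: "X \<in> C" "x \<in> X" "Y \<in> C" "y \<in> Y"
          using \<open>x \<in> \<Union>C\<close> \<open>y \<in> \<Union>C\<close> by auto
        then have "\<exists>Z \<in> C. x \<in> Z \<and> y \<in> Z" using lin[of X Y] by auto
        then show ?thesis using additive_subgroup.a_closed[OF add_sub] by blast
      qed
      show "r \<otimes> x \<in> \<Union>C" if "r \<in> carrier R" "x \<in> \<Union>C" for r x
        using that left_ideal.l_closed[OF li] by blast
    qed
    then show "\<Union>C \<in> A" using ne CA by (auto simp: A_def)
  qed
  then obtain M where M: "M \<in> A" and max: "\<And>J. \<lbrakk>J \<in> A; M \<subseteq> J\<rbrakk> \<Longrightarrow> J = M" by blast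
  have "maximal_left_ideal M R"
    unfolding maximal_left_ideal_def
  proof (intro conjI allI impI)
    show "left_ideal M R" "M \<noteq> carrier R" using M by (auto simp: A_def)
    fix J assume J: "left_ideal J R \<and> M \<subseteq> J"
    then show "J = M \<or> J = carrier R"
      using max[of J] M left_ideal.eq_carrier_if_one_mem[of J R] by (auto simp: A_def)
  qed
  then show ?thesis using that M by (auto simp: A_def)
qed

lemma (in ring) maximal_left_ideal_sum:
  assumes M: "maximal_left_ideal M R" and K: "left_ideal K R" "\<not> K \<subseteq> M" and x: "x \<in> carrier R"
  obtains k m where "k \<in> K" "m \<in> M" "x = k \<oplus> m"
proof -
  interpret M: left_ideal M R using M by (simp add: maximal_left_ideal_def)
  interpret K: left_ideal K R by fact
  let ?S = "{k \<oplus> m | k m. k \<in> K \<and> m \<in> M}"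
  have "M \<subseteq> ?S" by clarify (metis K.zero_closed M.a_Hcarr l_zero)
  moreover have "K \<subseteq> ?S" by clarify (metis M.zero_closed K.a_Hcarr r_zero)
  ultimately have "?S = carrier R"
    using M K(2) left_ideal_sum[OF K(1) M.left_ideal_axioms] unfolding maximal_left_ideal_def
    by (metis (lifting))
  then show ?thesis using x that by blast
qed

text \<open>The left ideal \<open>(M : c)\<close> is the annihilator of \<open>c + M\<close>, a nonzero element of the simple
  module \<open>R/M\<close>. Concretely, if \<open>sc \<notin> M\<close> then \<open>c = tsc + m\<close> for some \<open>t\<close> and some
  \<open>m \<in> M\<close>, so \<open>1 - ts\<close> lies in \<open>(M : c)\<close>.\<close>

lemma (in ring) maximal_left_ideal_colon:
  assumes M: "maximal_left_ideal M R" and c: "c \<in> carrier R" "c \<notin> M"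
  shows "maximal_left_ideal {r \<in> carrier R. r \<otimes> c \<in> M} R"
    (is "maximal_left_ideal ?L R")
  unfolding maximal_left_ideal_def
proof (intro conjI allI impI)
  interpret M: left_ideal M R using M by (simp add: maximal_left_ideal_def)
  show "left_ideal ?L R" by (rule left_ideal_colon[OF M.left_ideal_axioms c(1)])
  show "?L \<noteq> carrier R" using c l_one[OF c(1)] one_closed by (metis (mono_tags, lifting) mem_Collect_eq)
  fix J assume J: "left_ideal J R \<and> ?L \<subseteq> J"
  interpret J: left_ideal J R using J by simp
  show "J = ?L \<or> J = carrier R"
  proof (cases "J \<subseteq> ?L")
    case False
    then obtain s where s: "s \<in> J" "s \<otimes> c \<notin> M" by auto
    have sc: "s \<otimes> c \<in> carrier R" using s c by auto
    obtain k m where k: "k \<in> PIdl (s \<otimes> c)" and m: "m \<in> M" and eq: "c = k \<oplus> m"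
      using maximal_left_ideal_sum[OF M PIdl_left_ideal[OF sc] _ c(1)] mem_PIdl[OF sc] s by blast
    obtain t where t: "t \<in> carrier R" "k = t \<otimes> (s \<otimes> c)" using k by (auto simp: cgenideal_def)
    have ts: "t \<otimes> s \<in> J" using t s J.l_closed by auto
    have "(\<one> \<ominus> t \<otimes> s) \<otimes> c = c \<ominus> k"
      using t s c J.a_Hcarr by (simp add: minus_eq l_distr l_minus m_assoc)
    also have "\<dots> = m"
      using add_minus_cancel_left[of k m] t s sc M.a_Hcarr[OF m] eq[symmetric] by simp
    finally have "\<one> \<ominus> t \<otimes> s \<in> J" using m J ts by auto
    then have "(\<one> \<ominus> t \<otimes> s) \<oplus> t \<otimes> s \<in> J" using ts by auto
    then have "\<one> \<in> J" using ts J.a_Hcarr[OF ts] by (simp add: minus_eq a_assoc l_neg)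
    then show ?thesis using J.eq_carrier_if_one_mem by simp
  qed (use J in auto)
qed

text \<open>This is the fact that \<open>J(R)\<close> annihilates the simple module \<open>R/M\<close>; letting \<open>M\<close> vary
  shows that \<open>J(R)\<close>, defined through left ideals, is a right ideal as well. It holds because
  \<open>J(R)\<close> is contained in \<open>(M : c)\<close>, which is maximal or all of \<open>R\<close>.\<close>

lemma (in ring) jacobson_radical_mult_mem:
  assumes M: "maximal_left_ideal M R" and a: "a \<in> jacobson_radical R" and c: "c \<in> carrier R"
  shows "a \<otimes> c \<in> M"
proof (cases "c \<in> M")
  case True
  interpret M: left_ideal M R using M by (simp add: maximal_left_ideal_def)
  show ?thesis using True a M.l_closed by (auto simp: jacobson_radical_def)
next
  case False
  then show ?thesis
    using maximal_left_ideal_colon[OF M c] a by (auto simp: jacobson_radical_def)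
qed

text \<open>If a maximal left ideal \<open>M\<close> omits \<open>a\<close>, then \<open>1 = ra + m\<close> with \<open>m \<in> M\<close>, and
  multiplying by \<open>a\<close> on the left puts \<open>a = ara + am\<close> into \<open>M\<close>.\<close>

lemma (in ring) jacobson_radical_semiprime:
  assumes a: "a \<in> carrier R" and J: "sandwich R a a \<subseteq> jacobson_radical R"
  shows "a \<in> jacobson_radical R"
proof -
  have "a \<in> M" if M: "maximal_left_ideal M R" for M
  proof (rule ccontr)
    assume aM: "a \<notin> M"
    interpret M: left_ideal M R using M by (simp add: maximal_left_ideal_def)
    obtain k m where k: "k \<in> PIdl a" and m: "m \<in> M" and eq: "\<one> = k \<oplus> m"
      using maximal_left_ideal_sum[OF M PIdl_left_ideal[OF a] _ one_closed] mem_PIdl[OF a] aM by blast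
    obtain r where r: "r \<in> carrier R" "k = r \<otimes> a" using k by (auto simp: cgenideal_def)
    have "a = a \<otimes> (k \<oplus> m)" using a eq[symmetric] by simp
    also have "\<dots> = a \<otimes> r \<otimes> a \<oplus> a \<otimes> m"
      using a r m M.a_Hcarr by (simp add: r_distr m_assoc)
    also have "\<dots> \<in> M"
    proof -
      have "a \<otimes> r \<otimes> a \<in> M"
        using J M r by (auto simp: sandwich_def jacobson_radical_def)
      then show ?thesis using a m M.l_closed by blast
    qed
    finally show False using aM by simp
  qed
  then show ?thesis using a by (auto simp: jacobson_radical_def)
qed

section \<open>Maximal left ideals that are not essential\<close>

text \<open>A nonzero left ideal \<open>K\<close> that meets \<open>M\<close> trivially is a complement of \<open>M\<close>, by
  maximality, and \<open>e\<close> is the \<open>K\<close>-component of \<open>1\<close>. The same complement property of every nonzero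
  left ideal inside \<open>K\<close> makes \<open>K = Re\<close> minimal.\<close>

lemma (in ring) nonessential_maximal_left_ideal:
  assumes M: "maximal_left_ideal M R" and ness: "\<not> essential_left_ideal M R"
  obtains e where "e \<in> minimal_left_idempotents R" "M = {x \<in> carrier R. x \<otimes> e = \<zero>}"
proof -
  interpret M: left_ideal M R using M by (simp add: maximal_left_ideal_def)
  obtain K where K: "left_ideal K R" "K \<noteq> {\<zero>}" "M \<inter> K = {\<zero>}"
    using ness M.left_ideal_axioms by (auto simp: essential_left_ideal_def)
  interpret K: left_ideal K R by fact
  have not_sub: "\<not> J \<subseteq> M" if "left_ideal J R" "J \<subseteq> K" "J \<noteq> {\<zero>}" for J
  proof -
    interpret J: left_ideal J R by fact
    show ?thesis using that K(3) J.zero_closed by blast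
  qed
  obtain e m where e: "e \<in> K" and m: "m \<in> M" and em: "\<one> = e \<oplus> m"
    using maximal_left_ideal_sum[OF M K(1) not_sub[OF K(1) order_refl K(2)] one_closed] by blast
  have ec [simp]: "e \<in> carrier R" and mc [simp]: "m \<in> carrier R" using e m by auto
  have split: "x = x \<otimes> e \<oplus> x \<otimes> m" if "x \<in> carrier R" for x
    using that by (metis em r_distr r_one ec mc)
  have split': "x \<otimes> m = x \<ominus> x \<otimes> e" "x \<otimes> e = x \<ominus> x \<otimes> m" if x: "x \<in> carrier R" for x
  proof -
    have "(x \<otimes> e \<oplus> x \<otimes> m) \<ominus> x \<otimes> e = x \<otimes> m" using x by (simp add: add_minus_cancel_left)
    then show "x \<otimes> m = x \<ominus> x \<otimes> e" using split[OF x] by simp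
    have "(x \<otimes> m \<oplus> x \<otimes> e) \<ominus> x \<otimes> m = x \<otimes> e" using x by (simp add: add_minus_cancel_left)
    then show "x \<otimes> e = x \<ominus> x \<otimes> m" using split[OF x] x by (simp add: a_comm)
  qed
  \<comment> \<open>Right multiplication by \<open>e\<close> is the projection of \<open>R = K \<oplus> M\<close> onto \<open>K\<close>.\<close>
  have Ke: "x \<otimes> e = x" if x: "x \<in> K" for x
  proof -
    have "x \<otimes> m \<in> K" using x e K.l_closed[OF e] K.minus_closed split'(1)[of x] by auto
    moreover have "x \<otimes> m \<in> M" using x m M.l_closed by auto
    ultimately have "x \<otimes> m = \<zero>" using K(3) by blast
    then show ?thesis using split[of x] x by auto
  qed
  have Me: "x \<otimes> e = \<zero>" if x: "x \<in> M" for x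
  proof -
    have "x \<otimes> e \<in> M" using x m M.l_closed[OF m] M.minus_closed split'(2)[of x] by auto
    moreover have "x \<otimes> e \<in> K" using x e K.l_closed by auto
    ultimately show ?thesis using K(3) by blast
  qed
  have eq: "M = {x \<in> carrier R. x \<otimes> e = \<zero>}"
  proof (intro equalityI subsetI)
    fix x assume "x \<in> {x \<in> carrier R. x \<otimes> e = \<zero>}"
    then have "x \<in> carrier R" "x = x \<otimes> m" using split[of x] by auto
    then show "x \<in> M" using M.l_closed[OF m] by metis
  qed (use Me in auto)
  have PK: "PIdl e = K"
  proof (intro equalityI subsetI)
    show "x \<in> K" if "x \<in> PIdl e" for x using that K.l_closed[OF e] by (auto simp: cgenideal_def)
    show "x \<in> PIdl e" if "x \<in> K" for x
      unfolding cgenideal_def using Ke[OF that] that by (metis (mono_tags, lifting) K.a_Hcarr mem_Collect_eq)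
  qed
  have "minimal_left_ideal K R"
    unfolding minimal_left_ideal_def
  proof (intro conjI K allI impI)
    fix J assume J: "left_ideal J R \<and> J \<subseteq> K"
    interpret J: left_ideal J R using J by simp
    show "J = {\<zero>} \<or> J = K"
    proof (rule disjCI)
      assume "J \<noteq> K"
      show "J = {\<zero>}"
      proof (rule ccontr)
        assume "J \<noteq> {\<zero>}"
        then obtain j m' where j: "j \<in> J" "m' \<in> M" "e = j \<oplus> m'"
          using maximal_left_ideal_sum[OF M J.left_ideal_axioms not_sub[of J] ec] J by blast
        have "m' = e \<ominus> j" using j(3) add_minus_cancel_left[of j m'] j(1,2) by simp
        moreover have "e \<ominus> j \<in> K" using e j(1) J K.minus_closed by blast
        ultimately have "m' \<in> K" by simp
        then have "m' = \<zero>" using j K(3) by blast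
        then have "e \<in> J" using j by auto
        then have "K \<subseteq> J" using Ke J.l_closed by (metis K.a_Hcarr subsetI)
        then show False using J \<open>J \<noteq> K\<close> by simp
      qed
    qed
  qed
  then have "e \<in> minimal_left_idempotents R"
    using PK Ke[OF e] by (simp add: minimal_left_idempotents_def idempotents_def)
  then show ?thesis using that eq by blast
qed

section \<open>Square-zero elements\<close>

text \<open>If \<open>a\<^sup>n = 0\<close> with \<open>n \<ge> 2\<close>, then \<open>a\<^sup>n\<^sup>-\<^sup>1\<close> squares to zero because
  \<open>2(n - 1) \<ge> n\<close>, so the exponent descends to 1.\<close>

lemma (in ring) reduced_ringI:
  assumes "\<And>a. \<lbrakk>a \<in> carrier R; a \<otimes> a = \<zero>\<rbrakk> \<Longrightarrow> a = \<zero>"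
  shows "reduced_ring R"
proof -
  have *: "a = \<zero>" if a: "a \<in> carrier R" and "a [^] n = \<zero>" "0 < n" for a and n :: nat
    using that(2,3)
  proof (induction n rule: less_induct)
    case (less n)
    show ?case
    proof (cases "n = 1")
      case True
      then show ?thesis using less.prems a by simp
    next
      case False
      have exp: "(n - 1) + (n - 1) = n + (n - 2)" using False less.prems by arith
      have "a [^] (n - 1) \<otimes> a [^] (n - 1) = a [^] n \<otimes> a [^] (n - 2)"
        using a nat_pow_mult[OF a, of "n - 1" "n - 1"] nat_pow_mult[OF a, of n "n - 2"] exp by simp
      then have "a [^] (n - 1) \<otimes> a [^] (n - 1) = \<zero>" using less.prems a by simp
      then have "a [^] (n - 1) = \<zero>" by (rule assms[OF nat_pow_closed[OF a]])
      then show ?thesis using less.IH[of "n - 1"] less.prems False by simp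
    qed
  qed
  have "\<zero> [^] (1::nat) = \<zero>" by simp
  then have "\<zero> \<in> nilpotents R" unfolding nilpotents_def by blast
  with * show ?thesis by (auto simp: reduced_ring_def nilpotents_def)
qed

text \<open>NJ-reflexivity with \<open>x = y = a\<close> applies because \<open>(ara)\<^sup>2\<close> has the factor \<open>a\<^sup>2\<close>.\<close>

lemma (in ring) square_zero_mem_jacobson_radical:
  assumes NJ: "NJ_reflexive R" and a: "a \<in> carrier R" "a \<otimes> a = \<zero>"
  shows "a \<in> jacobson_radical R"
proof (rule jacobson_radical_semiprime[OF a(1)])
  have "a \<otimes> r \<otimes> a \<in> nilpotents R" if r: "r \<in> carrier R" for r
  proof -
    have "(a \<otimes> r \<otimes> a) \<otimes> (a \<otimes> r \<otimes> a) = a \<otimes> r \<otimes> (a \<otimes> a) \<otimes> r \<otimes> a"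
      using a(1) r by (simp add: m_assoc)
    then have "(a \<otimes> r \<otimes> a) [^] (2::nat) = \<zero>" using a r by (simp add: numeral_2_eq_2)
    then show ?thesis using a(1) r by (auto simp: nilpotents_def intro: exI[of _ 2])
  qed
  then show "sandwich R a a \<subseteq> jacobson_radical R"
    using NJ a(1) unfolding NJ_reflexive_def sandwich_def by blast
qed

text \<open>Otherwise \<open>M\<close> is the annihilator of an idempotent \<open>e\<close> that generates a minimal left
  ideal. MC2 turns \<open>aRe = 0\<close>, which holds for radical elements, into \<open>ea = 0\<close>, and so
  places \<open>e\<close> in its own annihilator.\<close>

lemma (in ring) maximal_left_ideal_essential_if_MC2:
  assumes MC2: "left_MC2 R" and a: "a \<in> jacobson_radical R"
    and M: "maximal_left_ideal M R" and ann: "{r \<in> carrier R. r \<otimes> a = \<zero>} \<subseteq> M"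
  shows "essential_left_ideal M R"
proof (rule ccontr)
  assume "\<not> essential_left_ideal M R"
  then obtain e where e: "e \<in> minimal_left_idempotents R"
      and eq: "M = {x \<in> carrier R. x \<otimes> e = \<zero>}"
    using nonessential_maximal_left_ideal[OF M] by blast
  have ec: "e \<in> carrier R" and ee: "e \<otimes> e = e"
    using e by (auto simp: minimal_left_idempotents_def idempotents_def)
  have ac: "a \<in> carrier R" using a by (simp add: jacobson_radical_def)
  have "a \<otimes> r \<otimes> e = \<zero>" if "r \<in> carrier R" for r
    using jacobson_radical_mult_mem[OF M a that] by (simp add: eq)
  then have "sandwich R a e = {\<zero>}" by (auto simp: sandwich_def intro: exI[of _ \<zero>])
  then have "sandwich R e a = {\<zero>}" using MC2 ac e by (simp add: left_MC2_def)
  then have "e \<otimes> \<one> \<otimes> a = \<zero>" by (auto simp: sandwich_def)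
  then have "e \<in> M" using ann ec by auto
  then have "e = \<zero>" using ee by (simp add: eq)
  then have "M = carrier R" by (auto simp: eq)
  then show False using M by (simp add: maximal_left_ideal_def)
qed

theorem proposition2p14:
  fixes R :: "('a, 'm) ring_scheme"
  assumes "ring R"
    and "NJ_reflexive R"
  shows "(semiprimitive R \<longrightarrow> reduced_ring R) \<and>
         (left_MC2 R \<and> all_simple_singular_Wnil_injective R \<longrightarrow> reduced_ring R)"
proof -
  note ring = assms(1)
  have J: "a \<in> jacobson_radical R" if "a \<in> carrier R" "a \<otimes>\<^bsub>R\<^esub> a = \<zero>\<^bsub>R\<^esub>" for a
    using ring.square_zero_mem_jacobson_radical[OF ring assms(2) that] .
  have "reduced_ring R" if "semiprimitive R"
    by (rule ring.reduced_ringI[OF ring]) (use J that in \<open>unfold semiprimitive_def, blast\<close>)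
  moreover have "reduced_ring R"
    if MC2: "left_MC2 R" and inj: "all_simple_singular_Wnil_injective R"
  proof (rule ring.reduced_ringI[OF ring], rule ccontr)
    fix a assume a: "a \<in> carrier R" "a \<otimes>\<^bsub>R\<^esub> a = \<zero>\<^bsub>R\<^esub>" "a \<noteq> \<zero>\<^bsub>R\<^esub>"
    have "left_ideal {r \<in> carrier R. r \<otimes>\<^bsub>R\<^esub> a = \<zero>\<^bsub>R\<^esub>} R"
      using ring.left_ideal_colon[OF ring ring.left_ideal_zero[OF ring] a(1)] by simp
    moreover have "\<one>\<^bsub>R\<^esub> \<notin> {r \<in> carrier R. r \<otimes>\<^bsub>R\<^esub> a = \<zero>\<^bsub>R\<^esub>}"
      using a monoid.l_one[OF ring.is_monoid[OF ring] a(1)] by simp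
    ultimately obtain M where M: "maximal_left_ideal M R"
        and ann: "{r \<in> carrier R. r \<otimes>\<^bsub>R\<^esub> a = \<zero>\<^bsub>R\<^esub>} \<subseteq> M"
      by (rule ring.maximal_left_ideal_exists[OF ring])
    interpret M: left_ideal M R using M by (simp add: maximal_left_ideal_def)
    have "essential_left_ideal M R"
      by (rule ring.maximal_left_ideal_essential_if_MC2[OF ring MC2 J[OF a(1,2)] M ann])
    then have "simple_left_module R (quotient_left_module R M) \<and>
        singular_left_module R (quotient_left_module R M)"
      by (intro conjI ring.quotient_simple[OF ring M] ring.quotient_singular[OF ring])
    then have W: "Wnil_injective R (quotient_left_module R M)"
      by (rule inj[unfolded all_simple_singular_Wnil_injective_def, THEN spec, THEN mp])
    obtain c where c: "c \<in> carrier R" "\<one>\<^bsub>R\<^esub> \<ominus>\<^bsub>R\<^esub> a \<otimes>\<^bsub>R\<^esub> c \<in> M"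
      by (rule ring.one_minus_mem_if_quotient_Wnil_injective[OF ring M.left_ideal_axioms W a ann])
    have "a \<otimes>\<^bsub>R\<^esub> c \<in> M"
      by (rule ring.jacobson_radical_mult_mem[OF ring M J[OF a(1,2)] c(1)])
    then have "(\<one>\<^bsub>R\<^esub> \<ominus>\<^bsub>R\<^esub> a \<otimes>\<^bsub>R\<^esub> c) \<oplus>\<^bsub>R\<^esub> a \<otimes>\<^bsub>R\<^esub> c \<in> M"
      by (rule additive_subgroup.a_closed[OF M.is_additive_subgroup c(2)])
    then have "\<one>\<^bsub>R\<^esub> \<in> M" using a c by (simp add: M.minus_eq M.a_assoc M.l_neg)
    then show False using M M.eq_carrier_if_one_mem by (simp add: maximal_left_ideal_def)
  qed
  ultimately show ?thesis by blast
qed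

end
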